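(* Consider an underloaded system, $\rho<1$. (i) Let $I\ge2$. Any customer type $i$ that is a leaf in the basic activity tree does not affect the local stability of the system. Namely, let us modify the system by removing type $i$, and then modifying (if necessary) the input rates $\lambda_k$ of the remaining types $k\in\mathcal I\setminus\{i\}$ so that the basic activity tree of the modified (underloaded) system is $\mathcal E\setminus\{(ij)\}$, where $(ij)$ is the (only) edge in $\mathcal E$ adjacent to $i$. Then the original system is locally stable if and only if the modified one is. (ii) A system with two (or one) nonleaf customer types is locally stable.
   Context: Model. Customer types $i\in\mathcal I$, $|\mathcal I|=I$; server pools $j\in\mathcal J$, $|\mathcal J|=J$ (finite). Parameters: $\lambda_i>0$, $\beta_j>0$, $\mu_{ij}\ge 0$ ($\mu_{ij}=0$ means pool $j$ cannot serve type $i$). Static planning problem (SPP): minimize $\rho$ over $(\lambda_{ij}),\rho$ subject to $\lambda_{ij}\ge0$, $\sum_j\lambda_{ij}=\lambda_i$ for all $i$, and $\sum_i\lambda_{ij}/(\beta_j\mu_{ij})\le\rho$ for all $j$. Standing assumption (complete resource pooling): the SPP has a unique optimal solution $(\lambda_{ij}),\rho$, and the set of basic activities $\mathcal E=\{(ij):\lambda_{ij}>0\}$ is the edge set of a (connected) tree on the vertex set $\mathcal I\cup\mathcal J$ (the basic activity tree). $\mathcal S(i)=\{j:(ij)\in\mathcal E\}$, $\mathcal C(j)=\{i:(ij)\in\mathcal E\}$. A leaf is a node of degree one in this tree. Matrix $A_u$. For $y\in\mathbb R^I$ let $z=My\in\mathbb R^{\mathcal E}$ be the unique solution of $\sum_{i\in\mathcal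 C(j)}z_{ij}=\eta\beta_j$ for all $j$ and $\sum_{j\in\mathcal S(i)}z_{ij}=y_i$ for all $i$, where $\eta=\sum_iy_i/\sum_j\beta_j$. $A_u$ is the $I\times I$ matrix of the linear map $y\mapsto\big(-\sum_{j\in\mathcal S(i)}\mu_{ij}(My)_{ij}\big)_{i}$; it depends only on $(\beta_j)$, $(\mu_{ij})$ and $\mathcal E$, and governs the underloaded fluid model near equilibrium through $(\dot\psi_i)=(\lambda_i)+A_u(\psi_i)$. An underloaded system is locally stable if all eigenvalues of its matrix $A_u$ have negative real part. *)

theory Defs
  imports Complex_Main
begin

section \<open>Service systems and the static planning problem\<close>

record ('i, 'j) service_system =
  types :: "'i set"
  pools :: "'j set"
  arrival :: "'i \<Rightarrow> real"                  (* lambda_i *)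
  pool_size :: "'j \<Rightarrow> real"                (* beta_j *)
  service_rate :: "'i \<Rightarrow> 'j \<Rightarrow> real"       (* mu_ij; 0 if pool j cannot serve type i *)

definition valid_system :: "('i, 'j) service_system \<Rightarrow> bool" where
  "valid_system S \<longleftrightarrow>
     finite (types S) \<and> types S \<noteq> {} \<and> finite (pools S) \<and> pools S \<noteq> {} \<and>
     (\<forall>i\<in>types S. arrival S i > 0) \<and>
     (\<forall>j\<in>pools S. pool_size S j > 0) \<and>
     (\<forall>i\<in>types S. \<forall>j\<in>pools S. service_rate S i j \<ge> 0)"

text \<open>
  The load that the flow \<open>x i j\<close> puts on pool \<open>j\<close> is infinite if \<open>x i j > 0\<close> and
  \<open>service_rate S i j = 0\<close>, whereas in HOL the quotient is then 0.  The clause on vanishing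
  service rates excludes such flows.
\<close>

definition spp_feasible ::
  "('i, 'j) service_system \<Rightarrow> ('i \<Rightarrow> 'j \<Rightarrow> real) \<Rightarrow> real \<Rightarrow> bool" where
  "spp_feasible S x \<rho> \<longleftrightarrow>
     (\<forall>i\<in>types S. \<forall>j\<in>pools S. x i j \<ge> 0) \<and>
     (\<forall>i\<in>types S. \<forall>j\<in>pools S. service_rate S i j = 0 \<longrightarrow> x i j = 0) \<and>
     (\<forall>i\<in>types S. (\<Sum>j\<in>pools S. x i j) = arrival S i) \<and>
     (\<forall>j\<in>pools S. (\<Sum>i\<in>types S. x i j / (pool_size S j * service_rate S i j)) \<le> \<rho>)"

definition spp_optimal ::
  "('i, 'j) service_system \<Rightarrow> ('i \<Rightarrow> 'j \<Rightarrow> real) \<Rightarrow> real \<Rightarrow> bool" where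
  "spp_optimal S x \<rho> \<longleftrightarrow>
     spp_feasible S x \<rho> \<and> (\<forall>x' \<rho>'. spp_feasible S x' \<rho>' \<longrightarrow> \<rho> \<le> \<rho>')"

text \<open>Only the values of \<open>x\<close> on \<open>types S \<times> pools S\<close> matter, so uniqueness refers to those.\<close>

definition spp_unique_optimal ::
  "('i, 'j) service_system \<Rightarrow> ('i \<Rightarrow> 'j \<Rightarrow> real) \<Rightarrow> real \<Rightarrow> bool" where
  "spp_unique_optimal S x \<rho> \<longleftrightarrow>
     spp_optimal S x \<rho> \<and>
     (\<forall>x' \<rho>'. spp_optimal S x' \<rho>' \<longrightarrow>
        \<rho>' = \<rho> \<and> (\<forall>i\<in>types S. \<forall>j\<in>pools S. x' i j = x i j))"

definition basic_activities ::
  "('i, 'j) service_system \<Rightarrow> ('i \<Rightarrow> 'j \<Rightarrow> real) \<Rightarrow> ('i \<times> 'j) set" where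
  "basic_activities S x = {(i, j). i \<in> types S \<and> j \<in> pools S \<and> x i j > 0}"


section \<open>Bipartite trees\<close>

text \<open>
  A set \<open>E\<close> of pairs is read as the edge set of an undirected graph whose vertices are the types
  and the pools, made disjoint by \<open>Inl\<close> and \<open>Inr\<close>.
\<close>

definition adjacent :: "('i \<times> 'j) set \<Rightarrow> 'i + 'j \<Rightarrow> 'i + 'j \<Rightarrow> bool" where
  "adjacent E u v \<longleftrightarrow>
     (\<exists>i j. (i, j) \<in> E \<and> (u = Inl i \<and> v = Inr j \<or> u = Inr j \<and> v = Inl i))"

definition is_cycle :: "('i \<times> 'j) set \<Rightarrow> ('i + 'j) list \<Rightarrow> bool" where
  "is_cycle E vs \<longleftrightarrow>
     length vs \<ge> 3 \<and> distinct vs \<and> successively (adjacent E) vs \<and> adjacent E (last vs) (hd vs)"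

definition is_bipartite_tree :: "'i set \<Rightarrow> 'j set \<Rightarrow> ('i \<times> 'j) set \<Rightarrow> bool" where
  "is_bipartite_tree I J E \<longleftrightarrow>
     E \<subseteq> I \<times> J \<and>
     (\<forall>u \<in> Inl ` I \<union> Inr ` J. \<forall>v \<in> Inl ` I \<union> Inr ` J. (adjacent E)\<^sup>*\<^sup>* u v) \<and>
     (\<nexists>vs. is_cycle E vs)"

definition serving_pools :: "('i \<times> 'j) set \<Rightarrow> 'i \<Rightarrow> 'j set" where
  "serving_pools E i = {j. (i, j) \<in> E}"

definition served_types :: "('i \<times> 'j) set \<Rightarrow> 'j \<Rightarrow> 'i set" where
  "served_types E j = {i. (i, j) \<in> E}"

definition leaf_type :: "('i \<times> 'j) set \<Rightarrow> 'i \<Rightarrow> bool" where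
  "leaf_type E i \<longleftrightarrow> card (serving_pools E i) = 1"

definition complete_resource_pooling ::
  "('i, 'j) service_system \<Rightarrow> ('i \<Rightarrow> 'j \<Rightarrow> real) \<Rightarrow> real \<Rightarrow> bool" where
  "complete_resource_pooling S x \<rho> \<longleftrightarrow>
     spp_unique_optimal S x \<rho> \<and> is_bipartite_tree (types S) (pools S) (basic_activities S x)"

text \<open>\<open>S\<close> is an underloaded system whose static planning problem is solved by \<open>x\<close> and \<open>\<rho>\<close>.\<close>

definition underloaded_system ::
  "('i, 'j) service_system \<Rightarrow> ('i \<Rightarrow> 'j \<Rightarrow> real) \<Rightarrow> real \<Rightarrow> bool" where
  "underloaded_system S x \<rho> \<longleftrightarrow>
     valid_system S \<and> complete_resource_pooling S x \<rho> \<and> \<rho> < 1"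


section \<open>The matrix of the underloaded fluid model\<close>

text \<open>
  Elements of the coordinate space of \<open>E\<close> are represented by functions \<open>z\<close> that vanish outside
  \<open>E\<close>; this makes the solution unique as a function if \<open>E\<close> is a tree.
\<close>

definition balanced_allocation ::
  "('i, 'j) service_system \<Rightarrow> ('i \<times> 'j) set \<Rightarrow> ('i \<Rightarrow> real) \<Rightarrow> ('i \<Rightarrow> 'j \<Rightarrow> real)" where
  "balanced_allocation S E y =
     (let \<eta> = (\<Sum>i\<in>types S. y i) / (\<Sum>j\<in>pools S. pool_size S j) in
      THE z. (\<forall>i j. (i, j) \<notin> E \<longrightarrow> z i j = 0) \<and>
             (\<forall>j\<in>pools S. (\<Sum>i\<in>served_types E j. z i j) = \<eta> * pool_size S j) \<and>
             (\<forall>i\<in>types S. (\<Sum>j\<in>serving_pools E i. z i j) = y i))"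

definition underloaded_map ::
  "('i, 'j) service_system \<Rightarrow> ('i \<times> 'j) set \<Rightarrow> ('i \<Rightarrow> real) \<Rightarrow> ('i \<Rightarrow> real)" where
  "underloaded_map S E y i =
     - (\<Sum>j\<in>serving_pools E i. service_rate S i j * balanced_allocation S E y i j)"

definition A_u ::
  "('i, 'j) service_system \<Rightarrow> ('i \<times> 'j) set \<Rightarrow> 'i \<Rightarrow> 'i \<Rightarrow> real" where
  "A_u S E i k = underloaded_map S E (\<lambda>l. if l = k then 1 else 0) i"

text \<open>Complex eigenvalues of a real square matrix whose rows and columns are indexed by \<open>I\<close>.\<close>

definition is_eigenvalue :: "'i set \<Rightarrow> ('i \<Rightarrow> 'i \<Rightarrow> real) \<Rightarrow> complex \<Rightarrow> bool" where
  "is_eigenvalue I A s \<longleftrightarrow>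
     (\<exists>v :: 'i \<Rightarrow> complex. (\<exists>i\<in>I. v i \<noteq> 0) \<and>
        (\<forall>i\<in>I. (\<Sum>k\<in>I. complex_of_real (A i k) * v k) = s * v i))"

definition locally_stable ::
  "('i, 'j) service_system \<Rightarrow> ('i \<times> 'j) set \<Rightarrow> bool" where
  "locally_stable S E \<longleftrightarrow> (\<forall>s. is_eigenvalue (types S) (A_u S E) s \<longrightarrow> Re s < 0)"


section \<open>Removing a customer type\<close>

definition remove_type ::
  "'i \<Rightarrow> ('i \<Rightarrow> real) \<Rightarrow> ('i, 'j) service_system \<Rightarrow> ('i, 'j) service_system" where
  "remove_type i arr S = S\<lparr>types := types S - {i}, arrival := arr\<rparr>"

end

theory Submission
  imports Defs
begin

text \<open>
  On a tree the flow equations have exactly one solution: a connected graph carries a unit flow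
  between any two nodes, and the support of a nonzero circulation has minimal degree two and hence
  contains a cycle.

  The row of \<open>A_u\<close> of a leaf \<open>i\<close> attached to \<open>j\<close> is \<open>- \<mu>\<^sub>i\<^sub>j\<close> times a unit
  vector, and deleting row and column \<open>i\<close> leaves the matrix of the reduced system, so that the two
  spectra differ at most by \<open>- \<mu>\<^sub>i\<^sub>j < 0\<close>.  A reduced system is obtained by handing the
  load of \<open>i\<close> on \<open>j\<close> over to another type served by \<open>j\<close>.

  By the same token, only eigenvectors supported on the nonleaf types matter for stability.  Two
  such types share at most one pool.  If they share one, minus the \<open>2 \<times> 2\<close> matrix has positive
  trace and determinant; otherwise all flows of a type are proportional to the pool sizes.
\<close>

section \<open>Flows on bipartite trees\<close>

lemma adjacent_sym: "adjacent E u v \<Longrightarrow> adjacent E v u"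
  by (auto simp: adjacent_def)

lemma adjacent_irrefl: "\<not> adjacent E u u"
  by (auto simp: adjacent_def)

lemma adjacent_mono: "adjacent E u v \<Longrightarrow> E \<subseteq> F \<Longrightarrow> adjacent F u v"
  by (auto simp: adjacent_def)

section \<open>Cycles and the vanishing of circulations on forests\<close>

text \<open>A path is prolonged at its head: the head has a neighbour other than its successor, and
  this neighbour either closes a cycle with an initial segment of the path or is a new node. Without
  cycles, paths would outgrow \<open>V\<close>.\<close>

lemma min_degree_two_imp_cycle:
  fixes R :: "'v \<Rightarrow> 'v \<Rightarrow> bool"
  assumes fin: "finite V" and V: "\<And>u v. R u v \<Longrightarrow> u \<in> V"
    and sym: "\<And>u v. R u v \<Longrightarrow> R v u" and irrefl: "\<And>u. \<not> R u u"
    and deg: "\<And>u v. R u v \<Longrightarrow> \<exists>w. w \<noteq> v \<and> R u w"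
    and edge: "R u0 v0"
  shows "\<exists>vs. length vs \<ge> 3 \<and> distinct vs \<and> successively R vs \<and> R (last vs) (hd vs)"
proof (rule ccontr)
  assume no_cycle: "\<not> ?thesis"
  \<comment> \<open>The path has \<open>n + 2\<close> nodes. The first two are named because the
    degree condition is applied to \<open>u\<close> with the neighbour \<open>v\<close> to be
    avoided.\<close>
  have path: "\<exists>u v ps. length ps = n \<and> distinct (u # v # ps) \<and> successively R (u # v # ps)" for n
  proof (induction n)
    case 0
    have "u0 \<noteq> v0" using edge irrefl by metis
    then show ?case using edge by (intro exI[of _ u0] exI[of _ v0]) auto
  next
    case (Suc n)
    then obtain u v ps where p: "length ps = n" "distinct (u # v # ps)" "successively R (u # v # ps)"
      by blast
    then obtain w where w: "w \<noteq> v" "R u w" using deg[of u v] by auto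
    have wu: "w \<noteq> u" using w irrefl by metis
    have "w \<notin> set ps"
    proof
      assume "w \<in> set ps"
      then obtain xs ys where ps: "ps = xs @ w # ys" by (meson split_list)
      let ?c = "u # v # xs @ [w]"
      have "distinct ?c" using p(2) ps by auto
      moreover have "successively R ((u # v # xs @ [w]) @ ys)" using p(3) ps by simp
      then have "successively R ?c" unfolding successively_append_iff by blast
      moreover have "R (last ?c) (hd ?c)" using sym[OF w(2)] by simp
      moreover have "length ?c \<ge> 3" by simp
      ultimately show False using no_cycle by blast
    qed
    then show ?case using p w wu sym[OF w(2)]
      by (intro exI[of _ w] exI[of _ u] exI[of _ "v # ps"]) auto
  qed
  obtain u v ps where p: "length ps = card V" "distinct (u # v # ps)" "successively R (u # v # ps)"
    using path by blast
  \<comment> \<open>\<open>V\<close> is only known to contain the first argument of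
    \<open>R\<close>, so the last node of a path is caught by symmetry. A single node need not be on
    an edge, hence the bound on the length.\<close>
  have "set qs \<subseteq> V" if "successively R qs" "length qs \<ge> 2" for qs
    using that
  proof (induction qs rule: induct_list012)
    case (3 a b qs)
    then show ?case using V sym by (cases qs) auto
  qed auto
  from this[OF p(3)] have "set (u # v # ps) \<subseteq> V" by simp
  then have "card (set (u # v # ps)) \<le> card V" by (rule card_mono[OF fin])
  then show False using distinct_card[OF p(2)] p(1) by simp
qed

text \<open>A vanishing sum cannot have exactly one nonzero term. So in the support \<open>F\<close>
  of \<open>z\<close> every edge has another edge at each of its two ends, and \<open>F\<close>,
  hence \<open>E\<close>, contains a cycle unless \<open>F\<close> is empty.\<close>

lemma circulation_eq_0:
  fixes z :: "'i \<Rightarrow> 'j \<Rightarrow> real"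
  assumes fin: "finite E" and acyclic: "\<nexists>vs. is_cycle E vs"
    and supp: "\<And>i j. (i, j) \<notin> E \<Longrightarrow> z i j = 0"
    and row: "\<And>i j. (i, j) \<in> E \<Longrightarrow> (\<Sum>j\<in>serving_pools E i. z i j) = 0"
    and col: "\<And>i j. (i, j) \<in> E \<Longrightarrow> (\<Sum>i\<in>served_types E j. z i j) = 0"
  shows "z i j = 0"
proof (rule ccontr)
  assume nz: "z i j \<noteq> 0"
  define F where "F = {(i, j). z i j \<noteq> 0}"
  have FE: "F \<subseteq> E" using supp by (auto simp: F_def)
  have finr: "finite (serving_pools E i)" for i
    using finite_imageI[OF fin, of snd] by (rule rev_finite_subset) (force simp: serving_pools_def)
  have finc: "finite (served_types E j)" for j
    using finite_imageI[OF fin, of fst] by (rule rev_finite_subset) (force simp: served_types_def)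
  have row2: "\<exists>j'. j' \<noteq> j \<and> (i, j') \<in> F" if "(i, j) \<in> F" for i j
  proof (rule ccontr)
    assume "\<not> ?thesis"
    then have "(\<Sum>j\<in>serving_pools E i - {j}. z i j) = 0" by (auto simp: F_def intro!: sum.neutral)
    moreover have "j \<in> serving_pools E i" using that FE by (auto simp: serving_pools_def)
    moreover have "(i, j) \<in> E" using that FE by auto
    ultimately show False using row[of i j] sum.remove[OF finr, of j i "z i"] that by (auto simp: F_def)
  qed
  have col2: "\<exists>i'. i' \<noteq> i \<and> (i', j) \<in> F" if "(i, j) \<in> F" for i j
  proof (rule ccontr)
    assume "\<not> ?thesis"
    then have "(\<Sum>i\<in>served_types E j - {i}. z i j) = 0" by (auto simp: F_def intro!: sum.neutral)
    moreover have "i \<in> served_types E j" using that FE by (auto simp: served_types_def)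
    moreover have "(i, j) \<in> E" using that FE by auto
    ultimately show False
      using col[of i j] sum.remove[OF finc, of i j "\<lambda>i. z i j"] that by (auto simp: F_def)
  qed
  have "\<exists>vs. length vs \<ge> 3 \<and> distinct vs \<and> successively (adjacent F) vs \<and> adjacent F (last vs) (hd vs)"
  proof (rule min_degree_two_imp_cycle)
    show "finite (Inl ` fst ` E \<union> Inr ` snd ` E)" using fin by auto
    show "u \<in> Inl ` fst ` E \<union> Inr ` snd ` E" if "adjacent F u v" for u v
      using that FE by (force simp: adjacent_def)
    show "\<exists>w. w \<noteq> v \<and> adjacent F u w" if "adjacent F u v" for u v
    proof -
      from that consider i j where "(i, j) \<in> F" "u = Inl i" "v = Inr j"
        | i j where "(i, j) \<in> F" "u = Inr j" "v = Inl i" by (auto simp: adjacent_def)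
      then show ?thesis
      proof cases
        case 1
        with row2 obtain j' where "j' \<noteq> j" "(i, j') \<in> F" by blast
        with 1 show ?thesis by (intro exI[of _ "Inr j'"]) (auto simp: adjacent_def)
      next
        case 2
        with col2 obtain i' where "i' \<noteq> i" "(i', j) \<in> F" by blast
        with 2 show ?thesis by (intro exI[of _ "Inl i'"]) (auto simp: adjacent_def)
      qed
    qed
    show "adjacent F (Inl i) (Inr j)" using nz by (auto simp: adjacent_def F_def)
  qed (auto intro: adjacent_sym simp: adjacent_irrefl)
  then obtain vs where "length vs \<ge> 3" "distinct vs" "successively (adjacent F) vs"
    "adjacent F (last vs) (hd vs)" by blast
  then have "is_cycle E vs"
    using FE by (auto simp: is_cycle_def intro: adjacent_mono successively_mono)
  with acyclic show False by blast
qed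

section \<open>Flows with prescribed divergence on connected graphs\<close>

text \<open>Net outflow of a node when edges point from types to pools. It merges the equations for
  types and for pools into one family, so that paths can be treated without regard to the side on
  which a node lies.\<close>

definition divergence ::
  "('i \<times> 'j) set \<Rightarrow> ('i \<Rightarrow> 'j \<Rightarrow> real) \<Rightarrow> 'i + 'j \<Rightarrow> real" where
  "divergence E z v = (case v of Inl i \<Rightarrow> \<Sum>j\<in>serving_pools E i. z i j
                               | Inr j \<Rightarrow> - (\<Sum>i\<in>served_types E j. z i j))"

lemma divergence_add:
  "divergence E (\<lambda>i j. z i j + z' i j) v = divergence E z v + divergence E z' v"
  by (auto simp: divergence_def sum.distrib split: sum.split)

lemma divergence_sum:
  "divergence E (\<lambda>i j. \<Sum>u\<in>U. c u * z u i j) v = (\<Sum>u\<in>U. c u * divergence E (z u) v)"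
proof (cases v)
  case (Inl i)
  then show ?thesis
    by (simp add: divergence_def sum_distrib_left) (rule sum.swap)
next
  case (Inr j)
  then show ?thesis
    by (simp add: divergence_def sum_distrib_left sum_negf) (rule sum.swap)
qed

lemma divergence_edge:
  assumes "finite E" "(i, j) \<in> E"
  shows "divergence E (\<lambda>i' j'. if i' = i \<and> j' = j then c else 0) v =
         c * of_bool (v = Inl i) - c * of_bool (v = Inr j)"
proof -
  have "finite (serving_pools E i)"
    using finite_imageI[OF assms(1), of snd] by (rule rev_finite_subset) (force simp: serving_pools_def)
  moreover have "finite (served_types E j)"
    using finite_imageI[OF assms(1), of fst] by (rule rev_finite_subset) (force simp: served_types_def)
  moreover have "j \<in> serving_pools E i" "i \<in> served_types E j"
    using assms(2) by (auto simp: serving_pools_def served_types_def)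
  ultimately show ?thesis
    by (cases v) (auto simp: divergence_def)
qed

text \<open>One unit travels along the path. An edge gets \<open>1\<close> if it is traversed from
  type to pool and \<open>-1\<close> if from pool to type; repeated edges simply add up.\<close>

lemma path_flow:
  assumes "(adjacent E)\<^sup>*\<^sup>* u v" "finite E"
  shows "\<exists>z. (\<forall>i j. (i, j) \<notin> E \<longrightarrow> z i j = 0) \<and>
             (\<forall>w. divergence E z w = of_bool (w = u) - of_bool (w = v))"
  using assms(1)
proof (induction rule: rtranclp_induct)
  case base
  show ?case by (rule exI[of _ "\<lambda>_ _. 0"]) (auto simp: divergence_def split: sum.split)
next
  case (step v w)
  then obtain z where z: "\<And>i j. (i, j) \<notin> E \<Longrightarrow> z i j = 0"
    "\<And>w. divergence E z w = of_bool (w = u) - of_bool (w = v)" by blast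
  from step(2) obtain i j and c :: real where e: "(i, j) \<in> E"
    and c: "c = 1 \<and> v = Inl i \<and> w = Inr j \<or> c = -1 \<and> v = Inr j \<and> w = Inl i"
    unfolding adjacent_def by blast
  let ?z = "\<lambda>i' j'. z i' j' + (if i' = i \<and> j' = j then c else 0)"
  have "\<forall>i j. (i, j) \<notin> E \<longrightarrow> ?z i j = 0" using z(1) e by auto
  moreover have "\<forall>x. divergence E ?z x = of_bool (x = u) - of_bool (x = w)"
    using c by (auto simp: divergence_add divergence_edge[OF assms(2) e] z(2))
  ultimately show ?case by (intro exI[of _ ?z]) auto
qed

text \<open>Every node \<open>u\<close> sends \<open>t u\<close> units to a fixed root
  \<open>r\<close>. The total arriving at \<open>r\<close> is \<open>sum t V = 0\<close>, so the
  root keeps only its own term.\<close>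

lemma connected_flow:
  assumes "finite E" "finite V" "\<forall>u\<in>V. \<forall>v\<in>V. (adjacent E)\<^sup>*\<^sup>* u v" "sum t V = 0"
  shows "\<exists>z. (\<forall>i j. (i, j) \<notin> E \<longrightarrow> z i j = 0) \<and> (\<forall>v\<in>V. divergence E z v = t v)"
proof (cases "V = {}")
  case True
  then show ?thesis by (intro exI[of _ "\<lambda>_ _. 0"]) auto
next
  case False
  then obtain r where r: "r \<in> V" by blast
  have "\<forall>u\<in>V. \<exists>z. (\<forall>i j. (i, j) \<notin> E \<longrightarrow> z i j = 0) \<and>
             (\<forall>w. divergence E z w = of_bool (w = u) - of_bool (w = r))"
    using path_flow assms r by blast
  then obtain f where f: "\<And>u i j. u \<in> V \<Longrightarrow> (i, j) \<notin> E \<Longrightarrow> f u i j = 0"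
    "\<And>u w. u \<in> V \<Longrightarrow> divergence E (f u) w = of_bool (w = u) - of_bool (w = r)"
    by metis
  let ?z = "\<lambda>i j. \<Sum>u\<in>V. t u * f u i j"
  have "divergence E ?z v = t v" if "v \<in> V" for v
  proof -
    have "divergence E ?z v = (\<Sum>u\<in>V. t u * of_bool (v = u)) - (\<Sum>u\<in>V. t u * of_bool (v = r))"
      by (simp add: divergence_sum f(2) right_diff_distrib sum_subtractf)
    also have "(\<Sum>u\<in>V. t u * of_bool (v = r)) = 0"
      using assms(4) by (simp flip: sum_distrib_right)
    also have "(\<Sum>u\<in>V. t u * of_bool (v = u)) = (\<Sum>u\<in>V. if v = u then t u else 0)"
      by (rule sum.cong) auto
    also have "\<dots> = t v" using that assms(2) by simp
    finally show ?thesis by simp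
  qed
  moreover have "\<forall>i j. (i, j) \<notin> E \<longrightarrow> ?z i j = 0" by (simp add: f(1))
  ultimately show ?thesis by (intro exI[of _ ?z]) auto
qed


section \<open>Balanced allocations\<close>

text \<open>The condition under the definite description in \<open>balanced_allocation\<close>, with
  \<eta> unfolded, so that existence and uniqueness can be treated separately.\<close>

definition is_balanced ::
  "('i, 'j) service_system \<Rightarrow> ('i \<times> 'j) set \<Rightarrow> ('i \<Rightarrow> real) \<Rightarrow> ('i \<Rightarrow> 'j \<Rightarrow> real) \<Rightarrow> bool" where
  "is_balanced S E y z \<longleftrightarrow>
     (\<forall>i j. (i, j) \<notin> E \<longrightarrow> z i j = 0) \<and>
     (\<forall>j\<in>pools S. (\<Sum>i\<in>served_types E j. z i j) =
        (\<Sum>i\<in>types S. y i) / (\<Sum>j\<in>pools S. pool_size S j) * pool_size S j) \<and>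
     (\<forall>i\<in>types S. (\<Sum>j\<in>serving_pools E i. z i j) = y i)"

lemma balanced_allocation_eq_The: "balanced_allocation S E y = (THE z. is_balanced S E y z)"
  by (simp add: balanced_allocation_def is_balanced_def Let_def)

text \<open>Arrival rates and the planning problem are left out, since \<open>A_u\<close> depends
  only on pool sizes, service rates and the tree. Thus removing a leaf stays within the locale
  whatever the new arrival rates are.\<close>

locale tree_system =
  fixes S :: "('i, 'j) service_system" and E :: "('i \<times> 'j) set"
  assumes fin_types: "finite (types S)" and fin_pools: "finite (pools S)"
    and pools_nonempty: "pools S \<noteq> {}"
    and pool_size_pos: "\<And>j. j \<in> pools S \<Longrightarrow> pool_size S j > 0"
    and tree: "is_bipartite_tree (types S) (pools S) E"
    and rate_pos: "\<And>i j. (i, j) \<in> E \<Longrightarrow> service_rate S i j > 0"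
begin

lemma E_sub: "E \<subseteq> types S \<times> pools S"
  using tree by (simp add: is_bipartite_tree_def)

lemma fin_E: "finite E"
  using E_sub fin_types fin_pools by (meson finite_SigmaI finite_subset)

lemma fin_serving: "finite (serving_pools E i)"
  using E_sub fin_pools by (auto simp: serving_pools_def intro: rev_finite_subset)

lemma fin_served: "finite (served_types E j)"
  using E_sub fin_types by (auto simp: served_types_def intro: rev_finite_subset)

lemma total_size_pos: "(\<Sum>j\<in>pools S. pool_size S j) > 0"
  using fin_pools pools_nonempty pool_size_pos by (simp add: sum_pos)

lemma is_balanced_unique:
  assumes "is_balanced S E y z" "is_balanced S E y z'"
  shows "z = z'"
proof (intro ext)
  fix i j
  have "z i j - z' i j = 0"
  proof (rule circulation_eq_0[OF fin_E, where z = "\<lambda>i j. z i j - z' i j"])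
    show "\<nexists>vs. is_cycle E vs" using tree by (simp add: is_bipartite_tree_def)
  qed (use assms E_sub in \<open>auto simp: is_balanced_def sum_subtractf\<close>)
  then show "z i j = z' i j" by simp
qed

text \<open>The value of \<eta> makes the total demand of the pools equal to the total supply of the
  types, which is the solvability condition of \<open>connected_flow\<close>.\<close>

lemma is_balanced_ex: "\<exists>z. is_balanced S E y z"
proof -
  define \<eta> where "\<eta> = (\<Sum>i\<in>types S. y i) / (\<Sum>j\<in>pools S. pool_size S j)"
  let ?t = "case_sum y (\<lambda>j. - (\<eta> * pool_size S j))"
  have "sum ?t (Inl ` types S \<union> Inr ` pools S) =
        (\<Sum>i\<in>types S. y i) + (\<Sum>j\<in>pools S. - (\<eta> * pool_size S j))"
    using fin_types fin_pools by (subst sum.union_disjoint) (auto simp: sum.reindex)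
  also have "\<dots> = (\<Sum>i\<in>types S. y i) - \<eta> * (\<Sum>j\<in>pools S. pool_size S j)"
    by (simp add: sum_negf sum_distrib_left)
  also have "\<dots> = 0" using total_size_pos by (simp add: \<eta>_def)
  finally have "sum ?t (Inl ` types S \<union> Inr ` pools S) = 0" .
  then obtain z where "\<forall>i j. (i, j) \<notin> E \<longrightarrow> z i j = 0"
    and z: "\<forall>v\<in>Inl ` types S \<union> Inr ` pools S. divergence E z v = ?t v"
    using connected_flow[OF fin_E, of "Inl ` types S \<union> Inr ` pools S" ?t] fin_types fin_pools tree
    by (auto simp: is_bipartite_tree_def)
  moreover have "divergence E z (Inl i) = y i" if "i \<in> types S" for i using z that by auto
  moreover have "divergence E z (Inr j) = - (\<eta> * pool_size S j)" if "j \<in> pools S" for j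
    using z that by auto
  ultimately have "is_balanced S E y z"
    by (auto simp: is_balanced_def divergence_def \<eta>_def)
  then show ?thesis by (rule exI[of _ z])
qed

lemma is_balanced_allocation: "is_balanced S E y (balanced_allocation S E y)"
proof -
  obtain z where z: "is_balanced S E y z" using is_balanced_ex by (rule exE)
  show ?thesis
    unfolding balanced_allocation_eq_The by (rule theI[where P = "is_balanced S E y", OF z is_balanced_unique[OF _ z]])
qed

lemma balanced_allocation_eqI: "is_balanced S E y z \<Longrightarrow> balanced_allocation S E y = z"
  by (rule is_balanced_unique[OF is_balanced_allocation])

lemma A_u_leaf_row:
  assumes "serving_pools E i = {j}" "i \<in> types S"
  shows "A_u S E i k = - service_rate S i j * of_bool (i = k)"
  using is_balanced_allocation[of "\<lambda>l. if l = k then 1 else 0"] assms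
  by (auto simp: A_u_def underloaded_map_def is_balanced_def)

text \<open>Eigenvectors may be complex, whereas \<open>balanced_allocation\<close> is real.
  Superposing the allocations \<open>m k\<close> of the unit vectors with weights \<open>v k\<close>
  gives a complex allocation in which the product of \<open>A_u\<close> with \<open>v\<close> can be
  read off.\<close>

lemma complex_allocation:
  fixes v :: "'i \<Rightarrow> complex"
  obtains z where "\<And>i j. (i, j) \<notin> E \<Longrightarrow> z i j = 0"
    "\<And>j. j \<in> pools S \<Longrightarrow> (\<Sum>i\<in>served_types E j. z i j) =
       (\<Sum>i\<in>types S. v i) / of_real (\<Sum>j\<in>pools S. pool_size S j) * of_real (pool_size S j)"
    "\<And>i. i \<in> types S \<Longrightarrow> (\<Sum>j\<in>serving_pools E i. z i j) = v i"
    "\<And>i. (\<Sum>k\<in>types S. of_real (A_u S E i k) * v k) =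
       - (\<Sum>j\<in>serving_pools E i. of_real (service_rate S i j) * z i j)"
proof -
  define m where "m k = balanced_allocation S E (\<lambda>l. if l = k then 1 else 0)" for k
  define z where "z i j = (\<Sum>k\<in>types S. of_real (m k i j) * v k)" for i j
  have m: "is_balanced S E (\<lambda>l. if l = k then 1 else 0) (m k)" for k
    unfolding m_def by (rule is_balanced_allocation)
  have "z i j = 0" if "(i, j) \<notin> E" for i j
    using m that by (auto simp: z_def is_balanced_def)
  moreover have "(\<Sum>i\<in>served_types E j. z i j) =
       (\<Sum>i\<in>types S. v i) / of_real (\<Sum>j\<in>pools S. pool_size S j) * of_real (pool_size S j)"
    if j: "j \<in> pools S" for j
  proof -
    have c: "(\<Sum>i\<in>served_types E j. m k i j) = 1 / (\<Sum>j\<in>pools S. pool_size S j) * pool_size S j"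
      if "k \<in> types S" for k
      using m[of k] that j fin_types by (auto simp: is_balanced_def)
    have "(\<Sum>i\<in>served_types E j. z i j) =
          (\<Sum>k\<in>types S. of_real (\<Sum>i\<in>served_types E j. m k i j) * v k)"
      unfolding z_def by (subst sum.swap) (simp add: sum_distrib_right)
    also have "\<dots> = (\<Sum>k\<in>types S. v k *
        (1 / of_real (\<Sum>j\<in>pools S. pool_size S j) * of_real (pool_size S j)))"
      by (rule sum.cong[OF refl]) (simp only: c of_real_mult of_real_divide of_real_1 mult.commute)
    also have "\<dots> = (\<Sum>i\<in>types S. v i) *
        (1 / of_real (\<Sum>j\<in>pools S. pool_size S j) * of_real (pool_size S j))"
      by (rule sum_distrib_right[symmetric])
    finally show ?thesis by simp
  qed
  moreover have "(\<Sum>j\<in>serving_pools E i. z i j) = v i" if i: "i \<in> types S" for i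
  proof -
    have c: "(\<Sum>j\<in>serving_pools E i. m k i j) = (if i = k then 1 else 0)" for k
      using m[of k] i by (auto simp: is_balanced_def)
    have "(\<Sum>j\<in>serving_pools E i. z i j) =
          (\<Sum>k\<in>types S. of_real (\<Sum>j\<in>serving_pools E i. m k i j) * v k)"
      unfolding z_def by (subst sum.swap) (simp add: sum_distrib_right)
    also have "\<dots> = (\<Sum>k\<in>types S. if i = k then v k else 0)"
      by (rule sum.cong[OF refl]) (simp add: c)
    finally show ?thesis using i fin_types by simp
  qed
  moreover have "(\<Sum>k\<in>types S. of_real (A_u S E i k) * v k) =
       - (\<Sum>j\<in>serving_pools E i. of_real (service_rate S i j) * z i j)" for i
    unfolding z_def sum_distrib_left
    by (subst sum.swap)
       (simp add: A_u_def underloaded_map_def m_def sum_distrib_right sum_negf mult.assoc)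
  ultimately show ?thesis by (rule that[of z])
qed

end


section \<open>Removing a leaf\<close>

text \<open>A path can only enter and leave \<open>i\<close> through \<open>j\<close>, so its visits
  to \<open>i\<close> can be cut out; cycles of the smaller graph are cycles of the larger
  one.\<close>

lemma tree_remove_leaf:
  assumes tree: "is_bipartite_tree I J E" and leaf: "serving_pools E i = {j}"
  shows "is_bipartite_tree (I - {i}) J (E - {(i, j)})"
proof -
  let ?E = "E - {(i, j)}"
  have ij: "(i, k) \<in> E \<longleftrightarrow> k = j" for k using leaf by (auto simp: serving_pools_def)
  \<comment> \<open>To let the induction pass through \<open>i\<close>, an end at \<open>i\<close>
    is replaced by its only neighbour \<open>j\<close>: a visit to \<open>i\<close> becomes a stay
    at \<open>j\<close>.\<close>
  have conn: "(adjacent ?E)\<^sup>*\<^sup>* u (if v = Inl i then Inr j else v)"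
    if "(adjacent E)\<^sup>*\<^sup>* u v" "u \<noteq> Inl i" for u v
    using that
  proof (induction rule: rtranclp_induct)
    case (step v w)
    show ?case
    proof (cases "v = Inl i \<or> w = Inl i")
      case True
      then show ?thesis using step ij by (auto simp: adjacent_def)
    next
      case False
      then have "adjacent ?E v w" using step(2) by (auto simp: adjacent_def)
      then show ?thesis using step False by (auto intro: rtranclp.rtrancl_into_rtrancl)
    qed
  qed auto
  have "(adjacent ?E)\<^sup>*\<^sup>* u v"
    if "u \<in> Inl ` (I - {i}) \<union> Inr ` J" "v \<in> Inl ` (I - {i}) \<union> Inr ` J" for u v
  proof -
    have "(adjacent E)\<^sup>*\<^sup>* u v" using tree that by (auto simp: is_bipartite_tree_def)
    moreover have "u \<noteq> Inl i" "v \<noteq> Inl i" using that by auto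
    ultimately show ?thesis using conn[of u v] by simp
  qed
  moreover have "\<nexists>vs. is_cycle ?E vs"
  proof
    assume "\<exists>vs. is_cycle ?E vs"
    then obtain vs where "is_cycle ?E vs" ..
    then have "is_cycle E vs"
      by (auto simp: is_cycle_def intro: adjacent_mono successively_mono)
    then show False using tree by (auto simp: is_bipartite_tree_def)
  qed
  moreover have "?E \<subseteq> (I - {i}) \<times> J"
    using tree ij by (auto simp: is_bipartite_tree_def)
  ultimately show ?thesis by (simp add: is_bipartite_tree_def)
qed

lemma remove_type_simps [simp]:
  "types (remove_type i arr S) = types S - {i}" "pools (remove_type i arr S) = pools S"
  "arrival (remove_type i arr S) = arr" "pool_size (remove_type i arr S) = pool_size S"
  "service_rate (remove_type i arr S) = service_rate S"
  by (simp_all add: remove_type_def)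

context tree_system
begin

lemma tree_system_remove_leaf:
  assumes leaf: "serving_pools E i = {j}"
  shows "tree_system (remove_type i arr S) (E - {(i, j)})"
  by unfold_locales
     (use fin_types fin_pools pools_nonempty pool_size_pos rate_pos tree_remove_leaf[OF tree leaf]
      in auto)

text \<open>The unit vector of \<open>k\<close> puts nothing on \<open>i\<close>. Its allocation in
  the reduced tree therefore also solves the equations of the full tree, with the same \<eta>, and
  uniqueness identifies the two.\<close>

lemma A_u_remove_leaf:
  assumes leaf: "serving_pools E i = {j}" and k: "k \<noteq> i" and l: "l \<noteq> i"
  shows "A_u (remove_type i arr S) (E - {(i, j)}) l k = A_u S E l k"
proof -
  let ?S = "remove_type i arr S" and ?E = "E - {(i, j)}"
  let ?y = "\<lambda>l. if l = k then 1 else 0 :: real"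
  interpret R: tree_system ?S ?E by (rule tree_system_remove_leaf[OF leaf])
  have ij: "(i, j') \<in> E \<longleftrightarrow> j' = j" for j' using leaf by (auto simp: serving_pools_def)
  define z where "z = balanced_allocation ?S ?E ?y"
  have z: "is_balanced ?S ?E ?y z" unfolding z_def by (rule R.is_balanced_allocation)
  have z0: "z i j = 0" using z by (simp add: is_balanced_def)
  have sp: "serving_pools ?E l = serving_pools E l" if "l \<noteq> i" for l
    using that by (auto simp: serving_pools_def)
  have "(\<Sum>i'\<in>served_types E j'. z i' j') = (\<Sum>i'\<in>served_types ?E j'. z i' j')" for j'
    by (rule sum.mono_neutral_right[OF fin_served])
       (use z0 in \<open>auto simp: served_types_def\<close>)
  moreover have "(\<Sum>l\<in>types S. ?y l) = (\<Sum>l\<in>types S - {i}. ?y l)"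
    using k by (intro sum.mono_neutral_right fin_types) auto
  moreover have "(\<Sum>j\<in>serving_pools E l. z l j) = ?y l" if "l \<in> types S" for l
  proof (cases "l = i")
    case True
    then show ?thesis using z0 k by (simp add: leaf)
  next
    case False
    then show ?thesis using z that by (simp add: is_balanced_def sp)
  qed
  ultimately have "is_balanced S E ?y z"
    using z by (simp add: is_balanced_def)
  then have "balanced_allocation S E ?y = z" by (rule balanced_allocation_eqI)
  then show ?thesis by (simp add: A_u_def underloaded_map_def sp[OF l] z_def)
qed

text \<open>Row \<open>i\<close> has only its diagonal entry. Eigenvectors of the reduced matrix
  extend by zero, eigenvectors with \<open>v i = 0\<close> restrict, and
  \<open>v i \<noteq> 0\<close> forces the eigenvalue to be minus the service rate on the leaf
  edge.\<close>

lemma locally_stable_remove_leaf: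
  assumes leaf: "serving_pools E i = {j}"
  shows "locally_stable S E \<longleftrightarrow> locally_stable (remove_type i arr S) (E - {(i, j)})"
proof -
  let ?A = "A_u S E" and ?A' = "A_u (remove_type i arr S) (E - {(i, j)})"
  have ijE: "(i, j) \<in> E" using leaf by (auto simp: serving_pools_def)
  then have i: "i \<in> types S" using E_sub by auto
  have \<mu>: "service_rate S i j > 0" using ijE by (rule rate_pos)
  have row_i: "(\<Sum>k\<in>types S. complex_of_real (?A i k) * v k) = - service_rate S i j * v i"
    for v :: "'i \<Rightarrow> complex"
  proof -
    have "(\<Sum>k\<in>types S. complex_of_real (?A i k) * v k) =
          (\<Sum>k\<in>types S. if i = k then - complex_of_real (service_rate S i j) * v k else 0)"
      by (rule sum.cong) (auto simp: A_u_leaf_row[OF leaf i])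
    then show ?thesis using i fin_types by simp
  qed
  have row: "(\<Sum>k\<in>types S. complex_of_real (?A l k) * v k) =
             (\<Sum>k\<in>types S - {i}. complex_of_real (?A' l k) * v k)"
    if "l \<noteq> i" "v i = 0" for v l
    using that i fin_types by (subst sum.remove[OF fin_types i]) (auto simp: A_u_remove_leaf[OF leaf])
  have "is_eigenvalue (types S) ?A s" if s: "is_eigenvalue (types S - {i}) ?A' s" for s
  proof -
    obtain v where v: "\<exists>l\<in>types S - {i}. v l \<noteq> 0"
      "\<forall>l\<in>types S - {i}. (\<Sum>k\<in>types S - {i}. complex_of_real (?A' l k) * v k) = s * v l"
      using s by (auto simp: is_eigenvalue_def)
    let ?v = "v(i := 0)"
    have "(\<Sum>k\<in>types S. complex_of_real (?A l k) * ?v k) = s * ?v l" if "l \<in> types S" for l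
    proof (cases "l = i")
      case True
      then show ?thesis using row_i[of ?v] by simp
    next
      case False
      then have "(\<Sum>k\<in>types S. complex_of_real (?A l k) * ?v k) =
        (\<Sum>k\<in>types S - {i}. complex_of_real (?A' l k) * ?v k)" by (intro row) auto
      also have "\<dots> = (\<Sum>k\<in>types S - {i}. complex_of_real (?A' l k) * v k)" by (rule sum.cong) auto
      finally show ?thesis using False v(2) that by simp
    qed
    moreover have "\<exists>l\<in>types S. ?v l \<noteq> 0" using v(1) by auto
    ultimately show ?thesis unfolding is_eigenvalue_def by blast
  qed
  moreover have "Re s < 0 \<or> is_eigenvalue (types S - {i}) ?A' s" if s: "is_eigenvalue (types S) ?A s" for s
  proof -
    obtain v where v: "\<exists>l\<in>types S. v l \<noteq> 0"
      "\<And>l. l \<in> types S \<Longrightarrow> (\<Sum>k\<in>types S. complex_of_real (?A l k) * v k) = s * v l"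
      using s by (auto simp: is_eigenvalue_def)
    show ?thesis
    proof (cases "v i = 0")
      case True
      have "(\<Sum>k\<in>types S - {i}. complex_of_real (?A' l k) * v k) = s * v l" if "l \<in> types S - {i}" for l
        using that row[of l v] v(2)[of l] True by simp
      moreover have "\<exists>l\<in>types S - {i}. v l \<noteq> 0" using v(1) True by auto
      ultimately show ?thesis unfolding is_eigenvalue_def by blast
    next
      case False
      have "s * v i = - service_rate S i j * v i" using v(2)[OF i] row_i[of v] by simp
      then have "s = - service_rate S i j" using False by (metis mult_cancel_right)
      then show ?thesis using \<mu> by simp
    qed
  qed
  ultimately show ?thesis by (auto simp: locally_stable_def)
qed

end


section \<open>The static planning problem after removal of a leaf\<close>

text \<open>Another type \<open>k\<close> served by \<open>j\<close> takes over the capacity that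
  \<open>i\<close> used there, and its arrival rate grows accordingly. All pool loads and \<rho>
  stay the same, which lets optimality and uniqueness pass from \<open>x\<close> to
  \<open>x'\<close>.\<close>

lemma ex_remove_leaf:
  assumes S: "underloaded_system S x \<rho>" and E: "E = basic_activities S x"
    and card: "card (types S) \<ge> 2" and leaf: "serving_pools E i = {j}"
  shows "\<exists>arr x' \<rho>'. underloaded_system (remove_type i arr S) x' \<rho>' \<and>
           basic_activities (remove_type i arr S) x' = E - {(i, j)}"
proof -
  have valid: "valid_system S" and opt: "spp_unique_optimal S x \<rho>" and "\<rho> < 1"
    and tree: "is_bipartite_tree (types S) (pools S) E"
    using S E by (auto simp: underloaded_system_def complete_resource_pooling_def)
  have feas: "spp_feasible S x \<rho>" and opt_x: "spp_optimal S x \<rho>"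
    using opt by (auto simp: spp_unique_optimal_def spp_optimal_def)
  have fin: "finite (types S)" "finite (pools S)" using valid by (auto simp: valid_system_def)
  have x_nonneg: "x l m \<ge> 0" if "l \<in> types S" "m \<in> pools S" for l m
    using feas that by (auto simp: spp_feasible_def)
  have E_iff: "(l, m) \<in> E \<longleftrightarrow> l \<in> types S \<and> m \<in> pools S \<and> x l m > 0" for l m
    by (simp add: E basic_activities_def)
  have rate: "service_rate S l m > 0" if "(l, m) \<in> E" for l m
    using that feas valid unfolding E_iff spp_feasible_def valid_system_def
    by (metis less_eq_real_def less_irrefl)
  have ij: "(i, m) \<in> E \<longleftrightarrow> m = j" for m using leaf by (auto simp: serving_pools_def)
  then have i: "i \<in> types S" and j: "j \<in> pools S" using E_iff by auto
  define T where "T = types S - {i}"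
  have tree': "is_bipartite_tree T (pools S) (E - {(i, j)})"
    unfolding T_def by (rule tree_remove_leaf[OF tree leaf])
  \<comment> \<open>The reduced tree still joins \<open>j\<close> to some remaining type; the first
    edge of such a path leads to \<open>k\<close>.\<close>
  obtain k where k: "k \<noteq> i" "(k, j) \<in> E"
  proof -
    have "T \<noteq> {}"
    proof
      assume "T = {}"
      then have "types S \<subseteq> {i}" by (auto simp: T_def)
      then have "card (types S) \<le> card {i}" by (intro card_mono) auto
      then show False using card by simp
    qed
    then obtain l where "l \<in> T" by blast
    then have "(adjacent (E - {(i, j)}))\<^sup>*\<^sup>* (Inr j) (Inl l)"
      using tree' j by (auto simp: is_bipartite_tree_def)
    then show ?thesis
      by (rule converse_rtranclpE) (use that ij in \<open>auto simp: adjacent_def\<close>)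
  qed
  then have kT: "k \<in> T" by (auto simp: T_def E_iff)
  \<comment> \<open>The ratio of service rates converts the flow of \<open>i\<close> into the flow
    of \<open>k\<close> that loads pool \<open>j\<close> equally.\<close>
  define \<delta> where "\<delta> = service_rate S k j / service_rate S i j * x i j"
  have pos: "service_rate S k j > 0" "service_rate S i j > 0" "x i j > 0" "x k j > 0"
    using rate[OF k(2)] rate[of i j] ij E_iff[of k j] E_iff[of i j] k by auto
  then have \<delta>: "\<delta> > 0" by (simp add: \<delta>_def)
  define x' where "x' l m = x l m + (if l = k \<and> m = j then \<delta> else 0)" for l m
  \<comment> \<open>The arrival rates are read off from \<open>x'\<close>. They are at least the old
    ones, hence positive.\<close>
  define arr where "arr l = (\<Sum>m\<in>pools S. x' l m)" for l
  let ?S = "remove_type i arr S"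
  define load where
    "load L y m = (\<Sum>l\<in>L. y l m / (pool_size S m * service_rate S l m))" for L y m
  have load_split: "load (types S) y m = y i m / (pool_size S m * service_rate S i m) + load T y m"
    for y m
    unfolding load_def T_def by (rule sum.remove[OF fin(1) i])
  have x'_ge: "x l m \<le> x' l m" for l m using \<delta> by (simp add: x'_def)
  have load_x': "load T x' m = load (types S) x m" if m: "m \<in> pools S" for m
  proof (cases "m = j")
    case True
    have "load T x' m = (\<Sum>l\<in>T. x l m / (pool_size S m * service_rate S l m) +
        (if l = k then \<delta> / (pool_size S m * service_rate S k m) else 0))"
      unfolding load_def by (rule sum.cong) (auto simp: x'_def True add_divide_distrib)
    also have "\<dots> = load T x m + \<delta> / (pool_size S m * service_rate S k m)"
      using kT fin by (simp add: sum.distrib load_def T_def)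
    also have "\<delta> / (pool_size S m * service_rate S k m) = x i m / (pool_size S m * service_rate S i m)"
      using pos by (simp add: \<delta>_def True)
    finally show ?thesis by (simp add: load_split)
  next
    case False
    then have "x i m = 0" using ij[of m] E_iff[of i m] i m x_nonneg[of i m] by auto
    moreover have "load T x' m = load T x m" using False by (simp add: load_def x'_def)
    ultimately show ?thesis by (simp add: load_split)
  qed
  have load_le: "load (types S) x m \<le> \<rho>" if "m \<in> pools S" for m
    using feas that by (auto simp: spp_feasible_def load_def)
  have feas': "spp_feasible ?S x' \<rho>"
    unfolding spp_feasible_def
  proof (intro conjI ballI impI)
    fix l m assume "l \<in> types ?S" "m \<in> pools ?S"
    then show "0 \<le> x' l m" using x_nonneg[of l m] x'_ge[of l m] by simp
  next
    fix l m assume "l \<in> types ?S" "m \<in> pools ?S" "service_rate ?S l m = 0"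
    then show "x' l m = 0" using feas pos by (auto simp: x'_def spp_feasible_def)
  next
    fix m assume "m \<in> pools ?S"
    then show "(\<Sum>l\<in>types ?S. x' l m / (pool_size ?S m * service_rate ?S l m)) \<le> \<rho>"
      using load_le[of m] load_x'[of m] by (simp add: load_def T_def)
  qed (simp add: arr_def)
  \<comment> \<open>A competitor of \<open>x'\<close> yields the competitor \<open>x + \<epsilon> (y - x')\<close> of \<open>x\<close>, because
    \<open>x\<close> and \<open>x'\<close> load every pool equally.\<close>
  have unique: "r = \<rho> \<and> (\<forall>l\<in>T. \<forall>m\<in>pools S. y l m = x' l m)"
    if y: "spp_feasible ?S y r" and r: "r \<le> \<rho>" for y r
  proof -
    \<comment> \<open>Chosen such that \<open>\<epsilon> * x' k j = x k j\<close>, which keeps the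
      perturbed flow nonnegative on \<open>(k, j)\<close>. Elsewhere \<open>x'\<close> equals
      \<open>x\<close>, and \<epsilon> \<le> 1 suffices.\<close>
    define \<epsilon> where "\<epsilon> = x k j / (x k j + \<delta>)"
    have \<epsilon>: "0 < \<epsilon>" "\<epsilon> \<le> 1" using pos \<delta> by (simp_all add: \<epsilon>_def)
    have load_y: "load T y m \<le> r" if "m \<in> pools S" for m
      using y that by (simp add: spp_feasible_def load_def T_def)
    define w where "w l m = (if l = i then x i m else x l m + \<epsilon> * (y l m - x' l m))" for l m
    have "spp_feasible S w \<rho>"
      unfolding spp_feasible_def
    proof (intro conjI ballI impI)
      fix l m assume lm: "l \<in> types S" "m \<in> pools S"
      show "0 \<le> w l m"
      proof (cases "l = i")
        case True
        then show ?thesis using x_nonneg lm by (simp add: w_def)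
      next
        case False
        then have "y l m \<ge> 0" using y lm by (simp add: spp_feasible_def)
        then have "\<epsilon> * y l m \<ge> 0" using \<epsilon> by simp
        moreover have "\<epsilon> * x' l m \<le> x l m"
        proof (cases "l = k \<and> m = j")
          case True
          then show ?thesis using pos \<delta> by (simp add: x'_def \<epsilon>_def)
        next
          case False
          then show ?thesis using \<epsilon> x_nonneg[OF lm] by (auto simp: x'_def mult_left_le_one_le)
        qed
        ultimately show ?thesis using False by (simp add: w_def right_diff_distrib)
      qed
      show "w l m = 0" if "service_rate S l m = 0"
        using that y feas feas' lm by (auto simp: w_def spp_feasible_def)
    next
      fix l assume l: "l \<in> types S"
      have "(\<Sum>m\<in>pools S. x l m) = arrival S l" using feas l by (simp add: spp_feasible_def)
      moreover have "(\<Sum>m\<in>pools S. y l m) = arr l" if "l \<noteq> i"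
        using y l that by (simp add: spp_feasible_def)
      ultimately show "(\<Sum>m\<in>pools S. w l m) = arrival S l"
        by (cases "l = i")
           (simp_all add: w_def sum.distrib sum_subtractf arr_def flip: sum_distrib_left)
    next
      fix m assume m: "m \<in> pools S"
      have "load T w m = (\<Sum>l\<in>T. x l m / (pool_size S m * service_rate S l m) +
          \<epsilon> * (y l m / (pool_size S m * service_rate S l m) - x' l m / (pool_size S m * service_rate S l m)))"
        unfolding load_def
        by (rule sum.cong) (auto simp: w_def T_def add_divide_distrib diff_divide_distrib right_diff_distrib)
      also have "\<dots> = load T x m + \<epsilon> * (load T y m - load T x' m)"
        by (simp add: load_def sum.distrib sum_subtractf flip: sum_distrib_left)
      finally have "load (types S) w m = load (types S) x m + \<epsilon> * (load T y m - load T x' m)"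
        by (simp add: load_split w_def)
      \<comment> \<open>Equal loads of \<open>x\<close> and \<open>x'\<close> turn the load of
        \<open>w\<close> into a convex combination of two loads bounded by \<rho>.\<close>
      also have "\<dots> = (1 - \<epsilon>) * load (types S) x m + \<epsilon> * load T y m"
        by (simp add: load_x' m algebra_simps)
      also have "\<dots> \<le> (1 - \<epsilon>) * \<rho> + \<epsilon> * \<rho>"
        using \<epsilon> load_le[OF m] load_y[OF m] r by (intro add_mono mult_left_mono) auto
      finally show "(\<Sum>l\<in>types S. w l m / (pool_size S m * service_rate S l m)) \<le> \<rho>"
        by (simp add: load_def algebra_simps)
    qed
    then have "spp_optimal S w \<rho>" using opt_x by (auto simp: spp_optimal_def)
    then have w: "\<forall>l\<in>types S. \<forall>m\<in>pools S. w l m = x l m"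
      using opt by (auto simp: spp_unique_optimal_def)
    have yx': "y l m = x' l m" if "l \<in> T" "m \<in> pools S" for l m
    proof -
      have "l \<in> types S" "l \<noteq> i" using that by (auto simp: T_def)
      moreover from this have "w l m = x l m" using w that by blast
      ultimately have "\<epsilon> * (y l m - x' l m) = 0" by (simp add: w_def)
      then show ?thesis using \<epsilon> by simp
    qed
    \<comment> \<open>Once \<open>y\<close> agrees with \<open>x'\<close>, the bound
      \<open>r\<close> holds for the loads of \<open>x\<close> too, and minimality of \<rho> yields
      the reverse inequality.\<close>
    have "load (types S) x m \<le> r" if m: "m \<in> pools S" for m
    proof -
      have "load T y m = load T x' m" by (simp add: load_def yx' m)
      then show ?thesis using load_y[OF m] load_x'[OF m] by simp
    qed
    then have "spp_feasible S x r" using feas by (simp add: spp_feasible_def load_def)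
    then have "\<rho> \<le> r" using opt_x by (simp add: spp_optimal_def)
    with r yx' show ?thesis by auto
  qed
  have opt': "spp_optimal ?S x' \<rho>"
    unfolding spp_optimal_def using feas' unique by (metis linear order_refl)
  have "spp_unique_optimal ?S x' \<rho>"
    unfolding spp_unique_optimal_def
  proof (intro conjI allI impI opt')
    fix y r assume y: "spp_optimal ?S y r"
    then have "spp_feasible ?S y r" "r \<le> \<rho>" using feas' by (auto simp: spp_optimal_def)
    from unique[OF this] show "r = \<rho>" "\<forall>l\<in>types ?S. \<forall>m\<in>pools ?S. y l m = x' l m"
      by (auto simp: T_def)
  qed
  moreover have basic: "basic_activities ?S x' = E - {(i, j)}"
    using ij E_iff \<delta> pos k x_nonneg by (auto simp: basic_activities_def x'_def add_pos_pos split: if_splits)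
  moreover have "valid_system ?S"
  proof -
    have "arr l > 0" if "l \<in> T" for l
    proof -
      have "0 < arrival S l" using valid that by (auto simp: valid_system_def T_def)
      also have "arrival S l = (\<Sum>m\<in>pools S. x l m)"
        using feas that by (auto simp: spp_feasible_def T_def)
      also have "\<dots> \<le> arr l" unfolding arr_def by (intro sum_mono x'_ge)
      finally show ?thesis .
    qed
    then show ?thesis using valid kT by (auto simp: valid_system_def T_def)
  qed
  ultimately have "underloaded_system ?S x' \<rho>"
    using tree' \<open>\<rho> < 1\<close> by (simp add: underloaded_system_def complete_resource_pooling_def T_def)
  with basic show ?thesis by blast
qed


section \<open>At most two nonleaf types\<close>

text \<open>The Routh-Hurwitz criterion in degree two. For a real root the other two terms are
  positive in sum, so \<open>T * s\<close> is negative; for a nonreal root the imaginary part of the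
  equation gives \<open>Re s = - T / 2\<close>.\<close>

lemma quadratic_root_Re_neg:
  fixes s :: complex and T D :: real
  assumes "s\<^sup>2 + T * s + D = 0" "T > 0" "D > 0"
  shows "Re s < 0"
proof (cases "Im s = 0")
  case True
  have "(Re s)\<^sup>2 + T * Re s + D = 0"
    using arg_cong[OF assms(1), of Re] True by (simp add: power2_eq_square)
  moreover have "(Re s)\<^sup>2 \<ge> 0" by simp
  ultimately have "T * Re s < 0" using assms(3) by linarith
  then show ?thesis using assms(2) by (simp add: mult_less_0_iff)
next
  case False
  have "Im s * (2 * Re s + T) = 0"
    using arg_cong[OF assms(1), of Im] by (simp add: power2_eq_square algebra_simps)
  then show ?thesis using False assms(2) by simp
qed

text \<open>Two types with contents \<open>v\<close> and \<open>w\<close> share one pool, where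
  their rates are \<open>m\<close> and \<open>n\<close>. The total sizes of their other pools are
  \<beta> and \<gamma>, the sums of rate times size over these are \<open>P\<close> and
  \<open>Q\<close>, and \<open>B\<close> is the size of all pools. The shared pool accounts for the
  strict inequality, which makes trace and determinant positive.\<close>

lemma two_type_eigenvalue_Re_neg:
  fixes s v w \<eta> :: complex and m n P Q \<beta> \<gamma> B :: real
  assumes pos: "m > 0" "n > 0" "P \<ge> 0" "Q \<ge> 0" "\<beta> \<ge> 0" "\<gamma> \<ge> 0" "\<beta> + \<gamma> < B"
    and nz: "v \<noteq> 0"
    and \<eta>: "\<eta> = (v + w) / B"
    and v: "s * v = - (m * (v - \<eta> * \<beta>) + \<eta> * P)"
    and w: "s * w = - (n * (w - \<eta> * \<gamma>) + \<eta> * Q)"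
  shows "Re s < 0"
proof -
  have B: "B > 0" using pos by linarith
  define p where "p = (P - m * \<beta>) / B"
  define q where "q = (Q - n * \<gamma>) / B"
  have "\<eta> * (P - m * \<beta>) = p * (v + w)" "\<eta> * (Q - n * \<gamma>) = q * (v + w)"
    using B by (simp_all add: \<eta> p_def q_def)
  then have vw: "s * v = - (m * v + p * (v + w))" "s * w = - (n * w + q * (v + w))"
    unfolding v w by (simp_all add: algebra_simps)
  have "(s + m + p) * v = - of_real p * w" using vw(1) by algebra
  moreover have "(s + n + q) * w = - of_real q * v" using vw(2) by algebra
  ultimately have "((s + m + p) * (s + n + q) - of_real p * of_real q) * v = 0" by algebra
  then have "(s + m + p) * (s + n + q) - of_real p * of_real q = 0" using nz by simp
  then have "s\<^sup>2 + of_real (m + n + p + q) * s + of_real (m * n + m * q + n * p) = 0"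
    by (simp add: power2_eq_square algebra_simps)
  moreover have "m + n + p + q > 0"
  proof -
    have "B * (m + n + p + q) = m * (B - \<beta>) + n * (B - \<gamma>) + P + Q"
      using B by (simp add: p_def q_def field_simps)
    also have "\<dots> > 0" using pos by (intro add_pos_nonneg add_pos_pos mult_pos_pos) auto
    finally show ?thesis using B by (simp add: zero_less_mult_iff)
  qed
  moreover have "m * n + m * q + n * p > 0"
  proof -
    have "B * (m * n + m * q + n * p) = m * n * (B - \<beta> - \<gamma>) + m * Q + n * P"
      using B by (simp add: p_def q_def field_simps)
    also have "\<dots> > 0" using pos by (intro add_pos_nonneg mult_pos_pos mult_nonneg_nonneg) auto
    finally show ?thesis using B by (simp add: zero_less_mult_iff)
  qed
  ultimately show ?thesis by (rule quadratic_root_Re_neg)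
qed

text \<open>Two types and two distinct common pools would form a cycle of length four.\<close>

lemma common_pool_unique:
  assumes "\<nexists>vs. is_cycle E vs" "(a, c) \<in> E" "(b, c) \<in> E" "(a, d) \<in> E" "(b, d) \<in> E" "a \<noteq> b"
  shows "c = d"
proof (rule ccontr)
  assume "c \<noteq> d"
  then have "is_cycle E [Inl a, Inr c, Inl b, Inr d]"
    using assms by (auto simp: is_cycle_def adjacent_def)
  with assms(1) show False by blast
qed

context tree_system
begin

text \<open>Instead of removing leaves one by one, a single eigenvector is examined. If it is
  nonzero at a leaf, that row decides. Otherwise leaves carry no flow, and a pool with only one
  nonleaf type is filled by that type alone.\<close>

lemma at_most_two_nonleaf_locally_stable:
  assumes card: "card {i\<in>types S. \<not> leaf_type E i} \<le> 2"
  shows "locally_stable S E"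
  unfolding locally_stable_def
proof (intro allI impI)
  fix s assume "is_eigenvalue (types S) (A_u S E) s"
  then obtain v where nz: "\<exists>i\<in>types S. v i \<noteq> 0"
    and eig: "\<And>i. i \<in> types S \<Longrightarrow> (\<Sum>k\<in>types S. of_real (A_u S E i k) * v k) = s * v i"
    by (auto simp: is_eigenvalue_def)
  define \<eta> where "\<eta> = (\<Sum>i\<in>types S. v i) / of_real (\<Sum>j\<in>pools S. pool_size S j)"
  obtain z where supp: "\<And>i j. (i, j) \<notin> E \<Longrightarrow> z i j = 0"
    and col: "\<And>j. j \<in> pools S \<Longrightarrow> (\<Sum>i\<in>served_types E j. z i j) = \<eta> * of_real (pool_size S j)"
    and row: "\<And>i. i \<in> types S \<Longrightarrow> (\<Sum>j\<in>serving_pools E i. z i j) = v i"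
    and Au: "\<And>i. (\<Sum>k\<in>types S. of_real (A_u S E i k) * v k) =
       - (\<Sum>j\<in>serving_pools E i. of_real (service_rate S i j) * z i j)"
    using complex_allocation[of v] unfolding \<eta>_def by blast
  have drift: "s * v i = - (\<Sum>j\<in>serving_pools E i. of_real (service_rate S i j) * z i j)"
    if "i \<in> types S" for i
    using eig[OF that] Au by simp
  have in_pools: "j \<in> pools S" if "j \<in> serving_pools E i" for i j
    using that E_sub by (auto simp: serving_pools_def)
  have rate: "service_rate S i j > 0" if "j \<in> serving_pools E i" for i j
    using that rate_pos by (auto simp: serving_pools_def)
  \<comment> \<open>Here \<open>- s\<close> is the average of the service rates of \<open>i\<close> weighted by the pool sizes.\<close>
  have proportional: "Re s < 0"
    if i: "i \<in> types S" "v i \<noteq> 0"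
      and z: "\<And>j. j \<in> serving_pools E i \<Longrightarrow> z i j = c * of_real (pool_size S j)" for i c
  proof -
    let ?\<beta> = "\<Sum>j\<in>serving_pools E i. pool_size S j"
    let ?P = "\<Sum>j\<in>serving_pools E i. service_rate S i j * pool_size S j"
    have vi: "v i = c * of_real ?\<beta>"
      using row[OF i(1)] z by (simp add: sum_distrib_left)
    have ne: "serving_pools E i \<noteq> {}" using row[OF i(1)] i(2) by auto
    have "?\<beta> > 0" "?P > 0"
      using fin_serving ne pool_size_pos in_pools rate by (auto intro!: sum_pos mult_pos_pos)
    moreover have "s * v i = - c * of_real ?P"
      using drift[OF i(1)] z by (simp add: sum_distrib_left sum_negf algebra_simps)
    then have "c * (s * of_real ?\<beta>) = c * of_real (- ?P)" by (simp add: vi algebra_simps)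
    \<comment> \<open>The factor \<open>c\<close> is nonzero because \<open>v i\<close> is.\<close>
    then have "s * of_real ?\<beta> = of_real (- ?P)" using vi i(2) by (metis mult_cancel_left mult_zero_left)
    then have "Re (s * of_real ?\<beta>) = Re (of_real (- ?P))" by (rule arg_cong)
    then have "Re s * ?\<beta> = - ?P" by (simp only: times_complex.sel Re_complex_of_real Im_complex_of_real)
    ultimately have "Re s * ?\<beta> < 0" "?\<beta> > 0" by linarith+
    then show ?thesis by (simp only: mult_less_0_iff) auto
  qed
  show "Re s < 0"
  proof (cases "\<exists>i\<in>types S. leaf_type E i \<and> v i \<noteq> 0")
    case True
    then obtain i j where i: "i \<in> types S" "v i \<noteq> 0" and j: "serving_pools E i = {j}"
      by (auto simp: leaf_type_def card_1_singleton_iff)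
    then have "pool_size S j \<noteq> 0" using pool_size_pos[of j] in_pools[of j i] by auto
    \<comment> \<open>With a single pool, proportionality is automatic.\<close>
    then show ?thesis
      using j by (intro proportional[OF i, where c = "z i j / of_real (pool_size S j)"]) auto
  next
    case False
    define N where "N = {i\<in>types S. \<not> leaf_type E i}"
    have finN: "finite N" using fin_types by (simp add: N_def)
    have v0: "v i = 0" if "i \<in> types S - N" for i using that False by (auto simp: N_def)
    \<comment> \<open>The only flow of a leaf equals its component of the eigenvector, which is zero
      in this case.\<close>
    have z0: "z i j = 0" if "i \<notin> N" for i j
    proof (cases "(i, j) \<in> E")
      case True
      then have i: "i \<in> types S" "leaf_type E i" using E_sub that by (auto simp: N_def)
      then obtain j' where "serving_pools E i = {j'}"
        by (auto simp: leaf_type_def card_1_singleton_iff)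
      then show ?thesis
        using row[OF i(1)] v0[of i] i(1) that True by (auto simp: serving_pools_def)
    qed (rule supp)
    have excl: "z i j = \<eta> * of_real (pool_size S j)"
      if "(i, j) \<in> E" "\<And>k. k \<in> N \<Longrightarrow> (k, j) \<in> E \<Longrightarrow> k = i" for i j
    proof -
      have "(\<Sum>k\<in>served_types E j. z k j) = (\<Sum>k\<in>{i}. z k j)"
        by (rule sum.mono_neutral_right[OF fin_served])
           (use that z0 in \<open>auto simp: served_types_def\<close>)
      then show ?thesis using col[of j] that(1) E_sub by auto
    qed
    obtain a where a: "a \<in> N" "v a \<noteq> 0" using nz v0 by blast
    then have aS: "a \<in> types S" by (simp add: N_def)
    show ?thesis
    \<comment> \<open>Either \<open>a\<close> shares no pool with another nonleaf type, and its
      flows are \<eta> times the pool sizes, or some \<open>b\<close> shares a pool \<open>c\<close>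
      with it and the cardinality bound leaves no further nonleaf type.\<close>
    proof (cases "\<forall>j\<in>serving_pools E a. \<forall>k\<in>N. (k, j) \<in> E \<longrightarrow> k = a")
      case True
      then show ?thesis
        by (intro proportional[OF aS a(2), where c = \<eta>] excl) (auto simp: serving_pools_def)
    next
      case False
      then obtain c b where cb: "(a, c) \<in> E" "(b, c) \<in> E" "b \<in> N" "b \<noteq> a"
        by (auto simp: serving_pools_def)
      have bS: "b \<in> types S" using cb by (simp add: N_def)
      have N: "N = {a, b}"
        using card cb a finN card_seteq[of N "{a, b}"] by (simp add: N_def)
      have no_cycle: "\<nexists>vs. is_cycle E vs" using tree by (simp add: is_bipartite_tree_def)
      \<comment> \<open>By acyclicity \<open>c\<close> is the only common pool, so the pools in
        \<open>U a\<close> and \<open>U b\<close> are exclusive and have known flows.\<close>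
      define U where "U i = serving_pools E i - {c}" for i
      have finU: "finite (U i)" for i using fin_serving by (simp add: U_def)
      have z_U: "z i j = \<eta> * of_real (pool_size S j)" if "i \<in> {a, b}" "j \<in> U i" for i j
        by (rule excl)
           (use that cb N common_pool_unique[OF no_cycle, of a c b j] in \<open>auto simp: U_def serving_pools_def\<close>)
      \<comment> \<open>The flow into the shared pool is what remains of \<open>v i\<close> after
        the flows into the exclusive pools.\<close>
      have type_eq: "s * v i = - (of_real (service_rate S i c) *
          (v i - \<eta> * of_real (\<Sum>j\<in>U i. pool_size S j)) +
          \<eta> * of_real (\<Sum>j\<in>U i. service_rate S i j * pool_size S j))"
        if i: "i \<in> {a, b}" for i
      proof -
        have c: "c \<in> serving_pools E i" using i cb by (auto simp: serving_pools_def)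
        have iS: "i \<in> types S" using i aS bS by auto
        have "(\<Sum>j\<in>U i. z i j) = \<eta> * of_real (\<Sum>j\<in>U i. pool_size S j)"
          by (simp add: z_U[OF i] sum_distrib_left)
        then have "z i c = v i - \<eta> * of_real (\<Sum>j\<in>U i. pool_size S j)"
          using row[OF iS] sum.remove[OF fin_serving c, of "z i"] by (simp add: U_def algebra_simps)
        moreover have "(\<Sum>j\<in>U i. of_real (service_rate S i j) * z i j) =
            \<eta> * of_real (\<Sum>j\<in>U i. service_rate S i j * pool_size S j)"
          by (simp add: z_U[OF i] sum_distrib_left mult_ac)
        ultimately show ?thesis
          using drift[OF iS]
            sum.remove[OF fin_serving c, of "\<lambda>j. of_real (service_rate S i j) * z i j"]
          by (simp add: U_def)
      qed
      have "(\<Sum>i\<in>types S. v i) = (\<Sum>i\<in>N. v i)"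
        by (rule sum.mono_neutral_right[OF fin_types]) (use v0 in \<open>auto simp: N_def\<close>)
      then have \<eta>: "\<eta> = (v a + v b) / of_real (\<Sum>j\<in>pools S. pool_size S j)"
        using cb by (simp add: \<eta>_def N)
      have "j = c" if "(a, j) \<in> E" "(b, j) \<in> E" for j
        using common_pool_unique[OF no_cycle that(1,2) cb(1,2)] cb(4) by simp
      then have disj: "U a \<inter> U b = {}" by (auto simp: U_def serving_pools_def)
      have c: "c \<in> pools S" using cb(1) E_sub by auto
      have "(\<Sum>j\<in>U a. pool_size S j) + (\<Sum>j\<in>U b. pool_size S j) = (\<Sum>j\<in>U a \<union> U b. pool_size S j)"
        by (rule sum.union_disjoint[OF finU finU disj, symmetric])
      \<comment> \<open>Strict because \<open>c\<close> lies in neither set and has positive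
        size.\<close>
      also have "\<dots> < (\<Sum>j\<in>pools S. pool_size S j)"
      proof (rule sum_strict_mono2[OF fin_pools])
        show "U a \<union> U b \<subseteq> pools S" using in_pools by (auto simp: U_def)
        show "c \<in> pools S - (U a \<union> U b)" using c by (simp add: U_def)
      qed (use c pool_size_pos in \<open>auto simp: less_imp_le\<close>)
      finally have less: "(\<Sum>j\<in>U a. pool_size S j) + (\<Sum>j\<in>U b. pool_size S j) <
        (\<Sum>j\<in>pools S. pool_size S j)" .
      have nonneg: "(\<Sum>j\<in>U i. pool_size S j) \<ge> 0"
        "(\<Sum>j\<in>U i. service_rate S i j * pool_size S j) \<ge> 0" for i
      proof -
        have "0 < pool_size S j" "0 < service_rate S i j" if "j \<in> U i" for j
          using that pool_size_pos in_pools rate by (auto simp: U_def)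
        then show "(\<Sum>j\<in>U i. pool_size S j) \<ge> 0"
          "(\<Sum>j\<in>U i. service_rate S i j * pool_size S j) \<ge> 0"
          by (simp_all add: sum_nonneg less_imp_le)
      qed
      show ?thesis
        by (rule two_type_eigenvalue_Re_neg[OF rate_pos[OF cb(1)] rate_pos[OF cb(2)]
              nonneg(2) nonneg(2) nonneg(1) nonneg(1) less a(2) \<eta> type_eq type_eq]) simp_all
    qed
  qed
qed

end

section \<open>From underloaded systems to trees, and the theorem\<close>

text \<open>Service rates on basic activities are positive because feasible flows vanish wherever
  the rate does.\<close>

lemma underloaded_tree_system:
  assumes "underloaded_system S x \<rho>" "E = basic_activities S x"
  shows "tree_system S E"
proof
  have feas: "spp_feasible S x \<rho>" and valid: "valid_system S"
    using assms by (auto simp: underloaded_system_def complete_resource_pooling_def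
        spp_unique_optimal_def spp_optimal_def)
  show "finite (types S)" "finite (pools S)" "pools S \<noteq> {}" "\<And>j. j \<in> pools S \<Longrightarrow> pool_size S j > 0"
    using valid by (auto simp: valid_system_def)
  show "is_bipartite_tree (types S) (pools S) E"
    using assms by (auto simp: underloaded_system_def complete_resource_pooling_def)
  fix i j assume "(i, j) \<in> E"
  then have "i \<in> types S" "j \<in> pools S" "x i j > 0"
    by (auto simp: assms(2) basic_activities_def)
  then show "service_rate S i j > 0"
    using feas valid unfolding spp_feasible_def valid_system_def
    by (metis less_eq_real_def less_irrefl)
qed

theorem lemma5p2:
  fixes S :: "('i, 'j) service_system"
    and x :: "'i \<Rightarrow> 'j \<Rightarrow> real" and \<rho> :: real and E :: "('i \<times> 'j) set"
  assumes S: "underloaded_system S x \<rho>"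
    and E: "E = basic_activities S x"
  shows "(card (types S) \<ge> 2 \<longrightarrow>
           (\<forall>i\<in>types S. \<forall>j. leaf_type E i \<and> (i, j) \<in> E \<longrightarrow>
              (\<exists>arr x' \<rho>'. underloaded_system (remove_type i arr S) x' \<rho>' \<and>
                 basic_activities (remove_type i arr S) x' = E - {(i, j)}) \<and>
              (\<forall>arr x' \<rho>'. underloaded_system (remove_type i arr S) x' \<rho>' \<and>
                 basic_activities (remove_type i arr S) x' = E - {(i, j)} \<longrightarrow>
                 (locally_stable S E \<longleftrightarrow>
                  locally_stable (remove_type i arr S)
                    (basic_activities (remove_type i arr S) x'))))) \<and>
         (card {i\<in>types S. \<not> leaf_type E i} \<in> {1, 2} \<longrightarrow> locally_stable S E)"
proof -
  interpret tree_system S E by (rule underloaded_tree_system[OF S E])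
  have leaf: "serving_pools E i = {j}" if i: "leaf_type E i" and j: "(i, j) \<in> E" for i j
  proof -
    obtain m where "serving_pools E i = {m}"
      using i by (auto simp: leaf_type_def card_1_singleton_iff)
    moreover have "j \<in> serving_pools E i" using j by (simp add: serving_pools_def)
    ultimately show ?thesis by simp
  qed
  show ?thesis
    using ex_remove_leaf[OF S E] locally_stable_remove_leaf at_most_two_nonleaf_locally_stable leaf
    by (intro conjI impI ballI allI) auto
qed

end
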